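(* Let $d\in\mathbb{N}$, $d\ge 1$, $p\in(1,\infty)$ and $m>0$ satisfy $m(p-1)>1$ and $dp>d+1$. For every $q\in[1,\infty]$, all $x,y\in\mathbb{R}^d$ and every $t\in[0,\infty)$, the Barenblatt flow $\mathsf{h}_\bullet$ satisfies $$W_q(\mathsf{h}_t\delta_x,\mathsf{h}_t\delta_y)=|x-y|.$$
   Context: Parameters: $\beta:=p+d(m(p-1)-1)$, $\gamma:=\frac{p-1}{m(p-1)-1}$, $\kappa:=\frac{m(p-1)-1}{mp}\beta^{-1/(p-1)}$, all positive. $\omega_{d-1}$ is the area of the unit sphere in $\mathbb{R}^d$ ($\omega_0=2$). For $t>0$, $r\ge 0$ let $U(t,r):=t^{-d/\beta}\,\max\{C-\kappa[t^{-1/\beta}r]^{p/(p-1)},0\}^\gamma$, where $C>0$ is the unique constant (depending only on $d,p,m$) such that $\omega_{d-1}\int_0^\infty U(t,r)r^{d-1}\,\mathrm{d}r=1$ for every $t>0$. The Barenblatt solution is $w^x(t,y):=U(t,|y-x|)$. Barenblatt flow: for $x\in\mathbb{R}^d$ and $t\ge 0$, $\mathsf{h}_t\delta_x$ is the time-$t$ marginal law of the Leibenson process started at $x$ (a weak solution of the McKean–Vlasov SDE associated with $\partial_tu=\Delta_pu^m$), whose marginals are prescribed: $\mathsf{h}_t\delta_x=w^x(t,\cdot)\,\mathscr{L}^d$ for $t>0$ and $\mathsf{h}_0\delta_x=\delta_x$. Wasserstein distance: for Borel probability measures $\mu,\nu$ on $\mathbb{R}^d$ and $q\in[1,\infty]$,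 $W_q(\mu,\nu):=\inf\|X-Y\|_{L^q(\Omega,\mathscr{F},\mathbf{P})}$, the infimum over all complete probability spaces $(\Omega,\mathscr{F},\mathbf{P})$ and random vectors $X,Y$ on it with laws $\mu$ and $\nu$, respectively. *)

theory Defs
  imports "HOL-Analysis.Analysis" "HOL-Probability.Probability"
begin

definition bar_beta :: "nat \<Rightarrow> real \<Rightarrow> real \<Rightarrow> real" where
  "bar_beta d p m = p + real d * (m * (p - 1) - 1)"

definition bar_gamma :: "real \<Rightarrow> real \<Rightarrow> real" where
  "bar_gamma p m = (p - 1) / (m * (p - 1) - 1)"

definition bar_kappa :: "nat \<Rightarrow> real \<Rightarrow> real \<Rightarrow> real" where
  "bar_kappa d p m = (m * (p - 1) - 1) / (m * p) * bar_beta d p m powr (- (1 / (p - 1)))"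

text \<open>Area of the unit sphere in dimension \<open>d\<close>, as \<open>d\<close> times the volume of the unit ball;
  for \<open>d = 1\<close> this is \<open>2\<close>.\<close>

definition unit_sphere_area :: "nat \<Rightarrow> real" where
  "unit_sphere_area d = real d * unit_ball_vol (real d)"

definition barenblatt_profile :: "nat \<Rightarrow> real \<Rightarrow> real \<Rightarrow> real \<Rightarrow> real \<Rightarrow> real \<Rightarrow> real" where
  "barenblatt_profile d p m C t r =
     t powr (- (real d / bar_beta d p m)) *
     max (C - bar_kappa d p m * (t powr (- (1 / bar_beta d p m)) * r) powr (p / (p - 1))) 0
       powr bar_gamma p m"

definition barenblatt_const :: "nat \<Rightarrow> real \<Rightarrow> real \<Rightarrow> real" where
  "barenblatt_const d p m =
     (THE C. C > 0 \<and>
        (\<forall>t>0. unit_sphere_area d *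
                 (LBINT r:{0..}. barenblatt_profile d p m C t r * r ^ (d - 1)) = 1))"

definition barenblatt :: "real \<Rightarrow> real \<Rightarrow> 'a::euclidean_space \<Rightarrow> real \<Rightarrow> 'a \<Rightarrow> real" where
  "barenblatt p m x t y =
     barenblatt_profile DIM('a) p m (barenblatt_const DIM('a) p m) t (norm (y - x))"

text \<open>\<open>barenblatt_flow p m t x\<close> is the measure \<open>h\<^sub>t \<delta>\<^sub>x\<close>, for \<open>t \<ge> 0\<close>: the prescribed
  time-\<open>t\<close> marginal law of the Leibenson process started at \<open>x\<close>.\<close>

definition barenblatt_flow :: "real \<Rightarrow> real \<Rightarrow> real \<Rightarrow> 'a::euclidean_space \<Rightarrow> 'a measure" where
  "barenblatt_flow p m t x =
     (if t = 0 then return borel x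
      else density lborel (\<lambda>y. ennreal (barenblatt p m x t y)))"

definition Lq_norm ::
  "ennreal \<Rightarrow> 'w measure \<Rightarrow> ('w \<Rightarrow> 'a::real_normed_vector) \<Rightarrow> ennreal" where
  "Lq_norm q M f =
     (if q = \<infinity> then esssup M (\<lambda>\<omega>. ennreal (norm (f \<omega>)))
      else let I = (\<integral>\<^sup>+ \<omega>. ennreal (norm (f \<omega>) powr enn2real q) \<partial>M)
           in if I = \<infinity> then \<infinity> else ennreal (enn2real I powr (1 / enn2real q)))"

text \<open>HOL cannot quantify over all probability spaces irrespective of their type, so the
  spaces \<open>M\<close> below live on the sum type \<open>('a \<times> 'a) + 'w\<close> for an arbitrary type \<open>'w\<close>.
  The left summand carries every coupling of \<open>\<mu>\<close> and \<open>\<nu>\<close> (the completed joint laws of \<open>X\<close>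
  and \<open>Y\<close>), so the value does not depend on \<open>'w\<close>; the right summand carries a copy of every
  complete probability space on \<open>'w\<close> (lemma \<open>wasserstein_le_any_space\<close>).  As \<open>'w\<close> does not
  occur in the type of the measures, it is passed explicitly as \<open>TYPE('w)\<close>.\<close>

definition wasserstein ::
  "'w itself \<Rightarrow> ennreal \<Rightarrow> 'a::euclidean_space measure \<Rightarrow> 'a measure \<Rightarrow> ennreal" where
  "wasserstein (_ :: 'w itself) q \<mu> \<nu> =
     Inf {Lq_norm q M (\<lambda>\<omega>. X \<omega> - Y \<omega>) | (M :: (('a \<times> 'a) + 'w) measure) X Y.
            prob_space M \<and> complete_measure M \<and>
            X \<in> M \<rightarrow>\<^sub>M borel \<and> Y \<in> M \<rightarrow>\<^sub>M borel \<and>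
            distr M borel X = \<mu> \<and> distr M borel Y = \<nu>}"

lemma Lq_norm_embed_Inr:
  fixes N :: "'w measure" and Z :: "'b + 'w \<Rightarrow> 'a::euclidean_space"
  assumes Z: "(\<lambda>w. Z (Inr w)) \<in> N \<rightarrow>\<^sub>M borel" "Z \<in> embed_measure N Inr \<rightarrow>\<^sub>M borel"
  shows "Lq_norm q (embed_measure N (Inr :: 'w \<Rightarrow> 'b + 'w)) Z = Lq_norm q N (\<lambda>w. Z (Inr w))"
proof -
  let ?M = "embed_measure N (Inr :: 'w \<Rightarrow> 'b + 'w)"
  have inj: "inj (Inr :: 'w \<Rightarrow> 'b + 'w)" by simp
  have I: "(\<integral>\<^sup>+ \<omega>. ennreal (norm (Z \<omega>) powr enn2real q) \<partial>?M) =
           (\<integral>\<^sup>+ \<omega>. ennreal (norm (Z (Inr \<omega>)) powr enn2real q) \<partial>N)"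
    using Z by (subst nn_integral_embed_measure[OF inj]) auto
  have AE: "(AE \<omega> in ?M. ennreal (norm (Z \<omega>)) \<le> z) \<longleftrightarrow>
            (AE \<omega> in N. ennreal (norm (Z (Inr \<omega>))) \<le> z)" for z
    by (rule AE_embed_measure[OF inj])
  have E: "esssup ?M (\<lambda>\<omega>. ennreal (norm (Z \<omega>))) = esssup N (\<lambda>\<omega>. ennreal (norm (Z (Inr \<omega>))))"
    using Z by (subst (1 2) esssup_eq_AE) (auto simp: AE)
  show ?thesis by (simp add: Lq_norm_def I E)
qed

lemma wasserstein_le_any_space:
  fixes N :: "'w measure" and X Y :: "'w \<Rightarrow> 'a::euclidean_space"
  assumes "prob_space N" "complete_measure N"
    and X: "X \<in> N \<rightarrow>\<^sub>M borel" and Y: "Y \<in> N \<rightarrow>\<^sub>M borel"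
  shows "wasserstein TYPE('w) q (distr N borel X) (distr N borel Y)
           \<le> Lq_norm q N (\<lambda>\<omega>. X \<omega> - Y \<omega>)"
proof -
  interpret N: prob_space N by fact
  interpret C: complete_measure N by fact
  let ?i = "Inr :: 'w \<Rightarrow> ('a \<times> 'a) + 'w"
  let ?M = "embed_measure N ?i"
  have inj: "inj ?i" by simp
  have ex: "case_sum (\<lambda>_. 0) Z \<in> ?M \<rightarrow>\<^sub>M borel" if "Z \<in> N \<rightarrow>\<^sub>M borel" for Z :: "'w \<Rightarrow> 'a"
    using that by (intro measurable_embed_measure1) simp
  have law: "distr ?M borel (case_sum (\<lambda>_. 0) Z) = distr N borel Z"
    if Z: "Z \<in> N \<rightarrow>\<^sub>M borel" for Z :: "'w \<Rightarrow> 'a"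
    by (subst embed_measure_eq_distr[OF inj])
      (simp add: distr_distr ex[OF Z] measurable_embed_measure2[OF inj] o_def)
  have "prob_space ?M"
    by (subst embed_measure_eq_distr[OF inj])
      (rule N.prob_space_distr[OF measurable_embed_measure2[OF inj]])
  moreover have "complete_measure ?M"
  proof
    fix A B assume AB: "B \<subseteq> A" "A \<in> null_sets ?M"
    then obtain A' where A': "A' \<in> sets N" "A = ?i ` A'"
      by (auto simp: null_sets_def sets_embed_measure[OF inj])
    then have "A' \<in> null_sets N"
      using AB by (auto simp: null_sets_def emeasure_embed_measure_image[OF inj])
    moreover have "B = ?i ` (?i -` B)" using AB A' by blast
    moreover have "?i -` B \<subseteq> A'" using AB A' by auto
    ultimately show "B \<in> sets ?M"
      using C.complete by (metis in_sets_embed_measure)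
  qed
  moreover have "Lq_norm q ?M (\<lambda>\<omega>. case_sum (\<lambda>_. 0) X \<omega> - case_sum (\<lambda>_. 0) Y \<omega>)
      = Lq_norm q N (\<lambda>\<omega>. X \<omega> - Y \<omega>)"
    by (subst Lq_norm_embed_Inr) (use X Y ex in auto)
  ultimately show ?thesis
    unfolding wasserstein_def
    by (intro Inf_lower CollectI exI[of _ ?M] exI[of _ "case_sum (\<lambda>_. 0) X"]
        exI[of _ "case_sum (\<lambda>_. 0) Y"]) (simp add: ex law X Y)
qed

end

theory Submission
  imports Defs
begin

text \<open>The laws \<open>h\<^sub>t \<delta>\<^sub>x\<close> are the translates by \<open>x\<close> of one compactly supported probability
  measure \<open>\<rho>\<close>. If \<open>Z\<close> has law \<open>\<rho>\<close>, then \<open>(x + Z, y + Z)\<close> is a coupling with constant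
  difference \<open>x - y\<close>, so the distance is at most \<open>norm (x - y)\<close>. Conversely every coupling
  \<open>(X, Y)\<close> has \<open>E (X - Y) = x - y\<close>, so that \<open>norm (x - y)\<close> is at most the \<open>L\<^sup>1\<close> norm, and
  a fortiori the \<open>L\<^sup>q\<close> norm, of \<open>X - Y\<close>.\<close>

section \<open>Wasserstein distance of translates\<close>

text \<open>Young's inequality with weights 1/q and 1 - 1/q, applied to 1 + q (v - 1) and 1, is the
  q-th root of the claim. Geometrically, the graph of v^q lies above its tangent at v = 1.\<close>

lemma Bernoulli_inequality_powr:
  fixes q v :: real
  assumes "q \<ge> 1" "v \<ge> 0"
  shows "1 + q * (v - 1) \<le> v powr q"
proof (cases "v = 0 \<or> 1 + q * (v - 1) \<le> 0")
  case True
  then show ?thesis using assms by (auto intro: order_trans)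
next
  case False
  then have v: "v > 0" and w: "1 + q * (v - 1) > 0" using assms by auto
  have "(1 + q * (v - 1)) powr (1 / q) * 1 powr (1 - 1 / q)
      \<le> 1 / q * (1 + q * (v - 1)) + (1 - 1 / q) * 1"
    using assms w by (intro Youngs_inequality_0) auto
  also have "\<dots> = v" using assms by (simp add: field_simps)
  finally have "((1 + q * (v - 1)) powr (1 / q)) powr q \<le> v powr q"
    using assms by (intro powr_mono2) auto
  then show ?thesis using assms w by (simp add: powr_powr)
qed

text \<open>Jensen's inequality for the convex function v^q, obtained by integrating its tangent at
  \<open>c\<close>. As \<open>c\<close> is only a lower bound of the mean, the mean may be
  infinite.\<close>

lemma (in prob_space) powr_le_nn_integral_powr:
  fixes f :: "'a \<Rightarrow> real"
  assumes [measurable]: "f \<in> borel_measurable M" and f: "\<And>x. f x \<ge> 0"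
    and q: "q \<ge> 1" and c: "c > 0" "ennreal c \<le> (\<integral>\<^sup>+x. ennreal (f x) \<partial>M)"
  shows "ennreal (c powr q) \<le> (\<integral>\<^sup>+x. ennreal (f x powr q) \<partial>M)"
proof -
  define I where "I = (\<integral>\<^sup>+x. ennreal (f x powr q) \<partial>M)"
  \<comment> \<open>Bernoulli's inequality at v = f x / c, scaled by c^q. The negative constant of
    the tangent is moved to the right, so that both sides are nonnegative and pass to
    \<open>ennreal\<close>; being finite, it is cancelled at the end.\<close>
  have tangent: "c powr q * q / c * f x \<le> f x powr q + c powr q * (q - 1)" for x
  proof -
    have "c powr q * (1 + q * (f x / c - 1)) \<le> c powr q * (f x / c) powr q"
      using Bernoulli_inequality_powr[of q "f x / c"] q c f[of x] by (intro mult_left_mono) auto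
    also have "\<dots> = f x powr q"
      using c f[of x] by (simp add: powr_divide)
    finally show ?thesis by (simp add: algebra_simps)
  qed
  have "ennreal (c powr q) + ennreal (c powr q * (q - 1)) = ennreal (c powr q * q / c) * ennreal c"
    using c q by (simp add: ennreal_mult'[symmetric] ennreal_plus[symmetric] algebra_simps del: ennreal_plus)
  also have "\<dots> \<le> ennreal (c powr q * q / c) * (\<integral>\<^sup>+x. ennreal (f x) \<partial>M)"
    using c by (intro mult_left_mono) auto
  also have "\<dots> = (\<integral>\<^sup>+x. ennreal (c powr q * q / c * f x) \<partial>M)"
    using c q f by (simp add: nn_integral_cmult[symmetric] ennreal_mult'[symmetric] del: times_divide_eq_left)
  also have "\<dots> \<le> (\<integral>\<^sup>+x. ennreal (f x powr q) + ennreal (c powr q * (q - 1)) \<partial>M)"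
    using tangent q by (intro nn_integral_mono) (simp add: ennreal_plus[symmetric] ennreal_leI del: ennreal_plus)
  also have "\<dots> = I + ennreal (c powr q * (q - 1))"
    by (subst nn_integral_add) (auto simp: I_def emeasure_space_1)
  finally show ?thesis
    unfolding I_def[symmetric] by (simp add: ennreal_add_left_cancel_le add.commute)
qed

lemma Lq_norm_ge_L1:
  assumes "prob_space M" and [measurable]: "Z \<in> borel_measurable M" and q: "q \<ge> 1"
    and c: "c \<ge> 0" "ennreal c \<le> (\<integral>\<^sup>+\<omega>. ennreal (norm (Z \<omega>)) \<partial>M)"
  shows "ennreal c \<le> Lq_norm q M (Z :: 'w \<Rightarrow> 'a::euclidean_space)"
proof -
  interpret prob_space M by fact
  \<comment> \<open>The case c = 0 is split off because the tangent argument divides by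
    \<open>c\<close>.\<close>
  consider "c = 0" | "q = \<infinity>" "c > 0" | "q \<noteq> \<infinity>" "c > 0" using c by force
  then show ?thesis
  proof cases
    case 2
    have "(\<integral>\<^sup>+\<omega>. ennreal (norm (Z \<omega>)) \<partial>M) \<le> (\<integral>\<^sup>+\<omega>. esssup M (\<lambda>\<omega>. ennreal (norm (Z \<omega>))) \<partial>M)"
      by (intro nn_integral_mono_AE esssup_AE)
    then show ?thesis using c 2 by (simp add: Lq_norm_def emeasure_space_1)
  next
    case 3
    define r where "r = enn2real q"
    have "q < top" using 3 by (simp add: top.not_eq_extremum)
    then have r: "r \<ge> 1" using q enn2real_mono[of 1 q] by (simp add: r_def)
    define I where "I = (\<integral>\<^sup>+\<omega>. ennreal (norm (Z \<omega>) powr r) \<partial>M)"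
    have "ennreal (c powr r) \<le> I"
      unfolding I_def using 3 r c by (intro powr_le_nn_integral_powr) auto
    \<comment> \<open>Finiteness of \<open>I\<close> matters, since \<open>enn2real\<close> sends
      infinity to 0. For infinite \<open>I\<close> the norm is infinite by definition.\<close>
    then have "c powr r \<le> enn2real I" if "I \<noteq> \<infinity>"
      using that enn2real_mono[of "ennreal (c powr r)" I] by (simp add: top.not_eq_extremum)
    then have "(c powr r) powr (1 / r) \<le> enn2real I powr (1 / r)" if "I \<noteq> \<infinity>"
      using that r by (intro powr_mono2) auto
    then show ?thesis
      using 3 r by (simp add: Lq_norm_def Let_def I_def[symmetric] r_def[symmetric] powr_powr ennreal_leI)
  qed auto
qed

lemma Lq_norm_const:
  assumes "prob_space M" and q: "q \<ge> 1"
  shows "Lq_norm q M (\<lambda>_. v :: 'a::euclidean_space) = ennreal (norm v)"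
proof -
  interpret prob_space M by fact
  show ?thesis
  proof (cases "q = \<infinity>")
    case True
    then show ?thesis by (simp add: Lq_norm_def esssup_const emeasure_space_1)
  next
    case False
    then have "q < top" by (simp add: top.not_eq_extremum)
    then have "enn2real q \<ge> 1" using q enn2real_mono[of 1 q] by simp
    then show ?thesis using False by (simp add: Lq_norm_def emeasure_space_1 powr_powr)
  qed
qed

text \<open>Null sets of the embedded measure are images of null sets, and a subset of an image is
  the image of its own preimage.\<close>

lemma complete_embed_measure:
  assumes "complete_measure N" and inj: "inj f"
  shows "complete_measure (embed_measure N f)"
proof
  interpret N: complete_measure N by fact
  fix A B assume AB: "B \<subseteq> A" "A \<in> null_sets (embed_measure N f)"
  then obtain A' where A': "A' \<in> sets N" "A = f ` A'"
    by (auto simp: null_sets_def sets_embed_measure[OF inj])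
  then have "A' \<in> null_sets N"
    using AB by (auto simp: null_sets_def emeasure_embed_measure_image[OF inj])
  moreover have "B = f ` (f -` B)" "f -` B \<subseteq> A'"
    using AB A' inj by (auto dest: injD)
  ultimately show "B \<in> sets (embed_measure N f)"
    using N.complete by (metis in_sets_embed_measure)
qed

section \<open>Bounds from couplings of two laws\<close>

lemma wasserstein_translates_le:
  fixes \<rho> :: "'a::euclidean_space measure"
  assumes \<rho>: "prob_space \<rho>" "sets \<rho> = sets borel" and q: "q \<ge> 1"
  shows "wasserstein TYPE('w) q (distr \<rho> borel ((+) x)) (distr \<rho> borel ((+) y))
    \<le> ennreal (norm (x - y))"
proof -
  interpret \<rho>: prob_space \<rho> by fact
  \<comment> \<open>The space is \<rho> itself, completed and placed on the diagonal of the left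
    summand; a single point z drives both translates.\<close>
  let ?f = "\<lambda>z. Inl (z, z) :: ('a \<times> 'a) + 'w"
  let ?N = "completion \<rho>"
  let ?M = "embed_measure ?N ?f"
  \<comment> \<open>The value \<open>u\<close> on the right summand makes \<open>?X x - ?X y\<close>
    equal to x - y at every point, hence literally a constant function.\<close>
  let ?X = "\<lambda>u. case_sum (\<lambda>(z, _). u + z) (\<lambda>_. u) :: ('a \<times> 'a) + 'w \<Rightarrow> 'a"
  have inj: "inj ?f" by (auto simp: inj_on_def)
  have [measurable]: "(+) u \<in> \<rho> \<rightarrow>\<^sub>M borel" for u
    by (subst measurable_cong_sets[OF \<rho>(2) refl]) simp
  have X[measurable]: "?X u \<in> ?M \<rightarrow>\<^sub>M borel" for u
    by (intro measurable_embed_measure1) (auto intro!: measurable_completion)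
  have law: "distr ?M borel (?X u) = distr \<rho> borel ((+) u)" for u
    by (subst embed_measure_eq_distr[OF inj])
      (simp add: distr_distr[OF X] measurable_embed_measure2[OF inj] o_def distr_completion)
  have M: "prob_space ?M"
    by (subst embed_measure_eq_distr[OF inj])
      (intro prob_space.prob_space_distr \<rho>.prob_space_completion measurable_embed_measure2 inj)
  have "complete_measure ?M"
    by (intro complete_embed_measure inj completion.complete_measure_axioms)
  moreover have "(\<lambda>\<omega>. ?X x \<omega> - ?X y \<omega>) = (\<lambda>_. x - y)"
    by (auto simp: fun_eq_iff split: sum.split)
  then have "Lq_norm q ?M (\<lambda>\<omega>. ?X x \<omega> - ?X y \<omega>) = ennreal (norm (x - y))"
    using Lq_norm_const[OF M q] by simp
  ultimately show ?thesis
    unfolding wasserstein_def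
    by (intro Inf_lower CollectI exI[of _ ?M] exI[of _ "?X x"] exI[of _ "?X y"]) (simp add: law M)
qed

lemma integrable_distr_ident:
  fixes X :: "'w \<Rightarrow> 'a::euclidean_space"
  assumes "X \<in> M \<rightarrow>\<^sub>M borel"
  shows "integrable (distr M borel X) (\<lambda>z. z) \<longleftrightarrow> integrable M X"
  by (rule integrable_distr_eq[OF assms measurable_ident_sets[OF refl]])

lemma integral_distr_ident:
  fixes X :: "'w \<Rightarrow> 'a::euclidean_space"
  assumes "X \<in> M \<rightarrow>\<^sub>M borel"
  shows "(\<integral>z. z \<partial>distr M borel X) = (\<integral>\<omega>. X \<omega> \<partial>M)"
  by (rule integral_distr[OF assms measurable_ident_sets[OF refl]])

text \<open>By linearity the expectation of X - Y depends on the two marginals only, so one bound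
  serves all couplings.\<close>

lemma dist_means_le_wasserstein:
  fixes \<mu> \<nu> :: "'a::euclidean_space measure"
  assumes "integrable \<mu> (\<lambda>z. z)" "integrable \<nu> (\<lambda>z. z)" and q: "q \<ge> 1"
  shows "ennreal (norm ((\<integral>z. z \<partial>\<mu>) - (\<integral>z. z \<partial>\<nu>))) \<le> wasserstein TYPE('w) q \<mu> \<nu>"
  unfolding wasserstein_def
proof (rule Inf_greatest)
  fix w assume "w \<in> {Lq_norm q M (\<lambda>\<omega>. X \<omega> - Y \<omega>) | (M :: (('a \<times> 'a) + 'w) measure) X Y.
            prob_space M \<and> complete_measure M \<and>
            X \<in> M \<rightarrow>\<^sub>M borel \<and> Y \<in> M \<rightarrow>\<^sub>M borel \<and>
            distr M borel X = \<mu> \<and> distr M borel Y = \<nu>}"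
  then obtain M :: "(('a \<times> 'a) + 'w) measure" and X Y
    where w: "w = Lq_norm q M (\<lambda>\<omega>. X \<omega> - Y \<omega>)" and M: "prob_space M"
      and [measurable]: "X \<in> M \<rightarrow>\<^sub>M borel" "Y \<in> M \<rightarrow>\<^sub>M borel"
      and \<mu>: "distr M borel X = \<mu>" and \<nu>: "distr M borel Y = \<nu>"
    by blast
  have int: "integrable M X" "integrable M Y"
    using assms(1,2) unfolding \<mu>[symmetric] \<nu>[symmetric]
    by (auto simp only: integrable_distr_ident \<open>X \<in> _\<close> \<open>Y \<in> _\<close>)
  have "(\<integral>z. z \<partial>\<mu>) - (\<integral>z. z \<partial>\<nu>) = (\<integral>\<omega>. X \<omega> - Y \<omega> \<partial>M)"
    unfolding \<mu>[symmetric] \<nu>[symmetric] using int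
    by (simp only: integral_distr_ident \<open>X \<in> _\<close> \<open>Y \<in> _\<close>) (rule Bochner_Integration.integral_diff[symmetric])
  also have "ennreal (norm \<dots>) \<le> (\<integral>\<^sup>+\<omega>. ennreal (norm (X \<omega> - Y \<omega>)) \<partial>M)"
    using int by (intro integral_norm_bound_ennreal) auto
  finally show "ennreal (norm ((\<integral>z. z \<partial>\<mu>) - (\<integral>z. z \<partial>\<nu>))) \<le> w"
    unfolding w by (intro Lq_norm_ge_L1 M q) auto
qed

lemma wasserstein_translates:
  fixes \<rho> :: "'a::euclidean_space measure"
  assumes \<rho>: "prob_space \<rho>" "sets \<rho> = sets borel" "integrable \<rho> (\<lambda>z. z)" and q: "q \<ge> 1"
  shows "wasserstein TYPE('w) q (distr \<rho> borel ((+) x)) (distr \<rho> borel ((+) y))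
    = ennreal (norm (x - y))"
proof (rule antisym[OF wasserstein_translates_le[OF \<rho>(1,2) q]])
  interpret \<rho>: prob_space \<rho> by fact
  have meas: "(+) u \<in> \<rho> \<rightarrow>\<^sub>M borel" for u
    by (subst measurable_cong_sets[OF \<rho>(2) refl]) simp
  have int: "integrable (distr \<rho> borel ((+) u)) (\<lambda>z. z)" for u
    unfolding integrable_distr_ident[OF meas] using \<rho>(3) by simp
  \<comment> \<open>The mean of \<rho> cancels in the difference of the means of two
    translates.\<close>
  have "(\<integral>z. z \<partial>distr \<rho> borel ((+) u)) = u + (\<integral>z. z \<partial>\<rho>)" for u
    unfolding integral_distr_ident[OF meas] using \<rho>(3) by (simp add: \<rho>.prob_space)
  then show "ennreal (norm (x - y))
      \<le> wasserstein TYPE('w) q (distr \<rho> borel ((+) x)) (distr \<rho> borel ((+) y))"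
    using dist_means_le_wasserstein[OF int int q, of x y] by simp
qed

section \<open>Mass of the Barenblatt profile\<close>

text \<open>It suffices to compare the half-lines \<open>{..a}\<close>, an intersection-stable
  generator. On the left they give volumes of balls; on the right, the fundamental theorem of
  calculus gives the same, as d times the unit ball volume is the sphere area.\<close>

lemma distr_norm_lborel:
  "distr lborel borel (norm :: 'a::euclidean_space \<Rightarrow> real) =
    density lborel (\<lambda>r. ennreal (unit_sphere_area DIM('a) * r ^ (DIM('a) - 1)) * indicator {0..} r)"
  (is "?L = ?R")
proof (rule measure_eqI_generator_eq[where E = "range atMost" and \<Omega> = UNIV
      and A = "\<lambda>i::nat. {..real i}"])
  have eq: "emeasure ?L {..a} = ennreal (unit_ball_vol DIM('a) * a ^ DIM('a))"
      "emeasure ?R {..a} = ennreal (unit_ball_vol DIM('a) * a ^ DIM('a))" if "a \<ge> 0" for a :: real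
  proof -
    have "norm -` {..a} = (cball 0 a :: 'a set)" by auto
    then show "emeasure ?L {..a} = ennreal (unit_ball_vol DIM('a) * a ^ DIM('a))"
      using that by (simp add: emeasure_distr emeasure_cball)
    let ?f = "\<lambda>r. unit_sphere_area DIM('a) * r ^ (DIM('a) - 1)"
    have "emeasure ?R {..a} = (\<integral>\<^sup>+r. ennreal (?f r) * indicator {0..a} r \<partial>lborel)"
      by (subst emeasure_density) (auto intro!: nn_integral_cong split: split_indicator)
    also have "\<dots> = ennreal (unit_ball_vol DIM('a) * a ^ DIM('a) - unit_ball_vol DIM('a) * 0 ^ DIM('a))"
      using that by (intro nn_integral_FTC_Icc)
        (auto simp: unit_sphere_area_def intro!: derivative_eq_intros)
    finally show "emeasure ?R {..a} = ennreal (unit_ball_vol DIM('a) * a ^ DIM('a))"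
      by (simp add: zero_power)
  qed
  have eq0: "emeasure ?L {..a} = 0" "emeasure ?R {..a} = 0" if "a < 0" for a :: real
  proof -
    have "norm -` {..a} = ({} :: 'a set)"
      using that by (auto dest: order_trans[OF norm_ge_zero])
    then show "emeasure ?L {..a} = 0" by (simp add: emeasure_distr)
    show "emeasure ?R {..a} = 0"
      using that by (subst emeasure_density) (auto intro!: nn_integral_zero' split: split_indicator)
  qed
  show "emeasure ?L X = emeasure ?R X" if X: "X \<in> range atMost" for X
  proof -
    obtain a where "X = {..a}" using X by blast
    then show ?thesis using eq[of a] eq0[of a] by (cases "a \<ge> 0") simp_all
  qed
  show "Int_stable (range (atMost :: real \<Rightarrow> _))"
    by (auto simp: Int_stable_def)
  show "emeasure ?L {..real i} \<noteq> \<infinity>" for i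
    by (subst eq) auto
  show "(\<Union>i. {..real i}) = UNIV"
    by (auto intro: real_arch_simple)
qed (auto simp: borel_eq_atMost)

text \<open>The radial integrand keeps the indicator of \<open>{0..}\<close> as a factor, to match
  the set integral that normalises the profile.\<close>

lemma nn_integral_lborel_norm:
  fixes f :: "real \<Rightarrow> real"
  assumes [measurable]: "f \<in> borel_measurable borel" and f: "\<And>r. r \<ge> 0 \<Longrightarrow> f r \<ge> 0"
  shows "(\<integral>\<^sup>+y. ennreal (f (norm (y :: 'a::euclidean_space))) \<partial>lborel) =
    ennreal (unit_sphere_area DIM('a)) *
      (\<integral>\<^sup>+r. ennreal (indicator {0..} r * (f r * r ^ (DIM('a) - 1))) \<partial>lborel)"
proof -
  have A: "unit_sphere_area DIM('a) \<ge> 0" by (simp add: unit_sphere_area_def)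
  have "(\<integral>\<^sup>+y. ennreal (f (norm (y :: 'a))) \<partial>lborel) = (\<integral>\<^sup>+r. ennreal (f r) \<partial>distr lborel borel (norm :: 'a \<Rightarrow> real))"
    by (subst nn_integral_distr) auto
  also have "\<dots> = (\<integral>\<^sup>+r. ennreal (unit_sphere_area DIM('a)) *
      ennreal (indicator {0..} r * (f r * r ^ (DIM('a) - 1))) \<partial>lborel)"
    unfolding distr_norm_lborel
  proof (subst nn_integral_density)
    have "ennreal (unit_sphere_area DIM('a) * r ^ (DIM('a) - 1)) * indicator {0..} r * ennreal (f r) =
        ennreal (unit_sphere_area DIM('a)) * ennreal (indicator {0..} r * (f r * r ^ (DIM('a) - 1)))"
      for r
      using A f[of r] by (cases "r \<ge> 0") (simp_all add: ennreal_mult'[symmetric] ennreal_mult''[symmetric] mult_ac)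
    then show "(\<integral>\<^sup>+r. ennreal (unit_sphere_area DIM('a) * r ^ (DIM('a) - 1)) * indicator {0..} r
          * ennreal (f r) \<partial>lborel) =
        (\<integral>\<^sup>+r. ennreal (unit_sphere_area DIM('a)) *
          ennreal (indicator {0..} r * (f r * r ^ (DIM('a) - 1))) \<partial>lborel)"
      by (simp only:)
  qed simp_all
  also have "\<dots> = ennreal (unit_sphere_area DIM('a)) *
      (\<integral>\<^sup>+r. ennreal (indicator {0..} r * (f r * r ^ (DIM('a) - 1))) \<partial>lborel)"
    by (rule nn_integral_cmult) measurable
  finally show ?thesis .
qed

section \<open>The reference profile and the normalising constant\<close>

locale barenblatt_params =
  fixes d :: nat and p m :: real
  assumes d: "d \<ge> 1" and p: "p > 1" and m: "m > 0" and mp: "m * (p - 1) > 1"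
begin

lemma beta_pos: "bar_beta d p m > 0"
  using p mp d by (simp add: bar_beta_def add_pos_nonneg)

lemma gamma_pos: "bar_gamma p m > 0"
  using p mp by (simp add: bar_gamma_def)

lemma kappa_pos: "bar_kappa d p m > 0"
  using p mp m beta_pos by (simp add: bar_kappa_def)

text \<open>The radial mass integrand in the reference case C = t = 1.\<close>

definition unit_integrand :: "real \<Rightarrow> real" where
  "unit_integrand s = indicator {0..} s *
    (max (1 - bar_kappa d p m * s powr (p / (p - 1))) 0 powr bar_gamma p m * s ^ (d - 1))"

lemma unit_integrand_measurable [measurable]: "unit_integrand \<in> borel_measurable borel"
  unfolding unit_integrand_def by measurable

lemma unit_integrand_nonneg: "unit_integrand s \<ge> 0"
  by (simp add: unit_integrand_def split: split_indicator)

text \<open>The free boundary of the reference profile: the root of \<kappa> s^(p/(p-1)) =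
  1.\<close>

definition radius :: real where "radius = (1 / bar_kappa d p m) powr ((p - 1) / p)"

lemma radius_pos: "radius > 0"
  using kappa_pos by (simp add: radius_def)

lemma radius_less_iff: "s \<ge> 0 \<Longrightarrow> s < radius \<longleftrightarrow> bar_kappa d p m * s powr (p / (p - 1)) < 1"
proof -
  assume s: "s \<ge> 0"
  have "radius powr (p / (p - 1)) = 1 / bar_kappa d p m"
    using kappa_pos p by (simp add: radius_def powr_powr)
  moreover have "s < radius \<longleftrightarrow> s powr (p / (p - 1)) < radius powr (p / (p - 1))"
    using s radius_pos p by (smt (verit) powr_less_mono2 powr_mono2 divide_pos_pos)
  ultimately show ?thesis
    using kappa_pos by (simp add: pos_less_divide_eq mult.commute)
qed

lemma unit_integrand_eq_0: "s \<ge> radius \<Longrightarrow> unit_integrand s = 0"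
  using radius_less_iff[of s] radius_pos by (simp add: unit_integrand_def max_def)

lemma unit_integrand_pos: "0 < s \<Longrightarrow> s < radius \<Longrightarrow> unit_integrand s > 0"
  using radius_less_iff[of s] by (simp add: unit_integrand_def)

lemma unit_integrand_integrable: "integrable lborel unit_integrand"
proof (rule integrableI_bounded_set[where A = "{0..radius}" and B = "radius ^ (d - 1)"])
  show "AE s in lborel. s \<in> {0..radius} \<longrightarrow> norm (unit_integrand s) \<le> radius ^ (d - 1)"
  proof (intro AE_I2 impI)
    fix s assume s: "s \<in> {0..radius}"
    have "max (1 - bar_kappa d p m * s powr (p / (p - 1))) 0 powr bar_gamma p m \<le> 1 powr bar_gamma p m"
      using gamma_pos kappa_pos by (intro powr_mono2) auto
    then have "max (1 - bar_kappa d p m * s powr (p / (p - 1))) 0 powr bar_gamma p m * s ^ (d - 1)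
      \<le> 1 * radius ^ (d - 1)"
      using s by (intro mult_mono power_mono) auto
    then show "norm (unit_integrand s) \<le> radius ^ (d - 1)"
      using s by (simp add: unit_integrand_def)
  qed
  show "AE s in lborel. s \<notin> {0..radius} \<longrightarrow> unit_integrand s = 0"
  proof (intro AE_I2 impI)
    fix s assume "s \<notin> {0..radius}"
    then have "s < 0 \<or> s \<ge> radius" by auto
    then show "unit_integrand s = 0"
      using unit_integrand_eq_0[of s] by (auto simp: unit_integrand_def)
  qed
qed (use radius_pos in simp_all)

text \<open>A vanishing integral would make the nonnegative integrand zero almost everywhere, yet it
  is positive on an interval of positive length.\<close>

lemma unit_mass_pos: "integral\<^sup>L lborel unit_integrand > 0"
proof (rule ccontr)
  assume "\<not> ?thesis"
  then have "integral\<^sup>L lborel unit_integrand = 0"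
    using integral_nonneg_AE[of unit_integrand lborel] unit_integrand_nonneg by fastforce
  then have "AE s in lborel. unit_integrand s = 0"
    using unit_integrand_integrable unit_integrand_nonneg by (simp add: integral_nonneg_eq_0_iff_AE)
  then have "AE s in lborel. s \<notin> {0<..<radius}"
    by eventually_elim (use unit_integrand_pos in force)
  then have "emeasure lborel {0<..<radius} = 0"
    by (subst (asm) AE_iff_measurable[where N = "{0<..<radius}"]) auto
  then show False using radius_pos by simp
qed

text \<open>The profile with constant \<open>C\<close> at time \<open>t\<close> is a multiple of the one with \<open>C = t = 1\<close>,
  evaluated at \<open>scale C t * r\<close>. Hence its mass is a power of \<open>C\<close> with positive exponent,
  which makes the normalising constant exist and be unique.\<close>

definition scale :: "real \<Rightarrow> real \<Rightarrow> real" where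
  "scale C t = t powr (- (1 / bar_beta d p m)) * C powr (- ((p - 1) / p))"

text \<open>Raising \<open>scale C t\<close> to the power p/(p-1) turns its factor C^(-(p-1)/p) into
  1/C, so C factors out of the maximum.\<close>

lemma profile_eq:
  assumes "C > 0" "t > 0" "r \<ge> 0"
  shows "barenblatt_profile d p m C t r = t powr (- (real d / bar_beta d p m)) * C powr bar_gamma p m *
    max (1 - bar_kappa d p m * (scale C t * r) powr (p / (p - 1))) 0 powr bar_gamma p m"
proof -
  define a where "a = t powr (- (1 / bar_beta d p m))"
  have "(scale C t * r) powr (p / (p - 1)) = (a * r) powr (p / (p - 1)) * C powr (- 1)"
    using assms p by (simp add: scale_def a_def powr_mult powr_powr field_simps)
  then have "C * (1 - bar_kappa d p m * (scale C t * r) powr (p / (p - 1))) =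
      C - bar_kappa d p m * (a * r) powr (p / (p - 1))"
    using assms by (simp add: powr_minus_divide field_simps)
  then have "max (C - bar_kappa d p m * (a * r) powr (p / (p - 1))) 0 =
      C * max (1 - bar_kappa d p m * (scale C t * r) powr (p / (p - 1))) 0"
    using assms by (metis max_mult_distrib_left mult_zero_right less_imp_le)
  then show ?thesis
    using assms by (simp add: barenblatt_profile_def a_def[symmetric] powr_mult)
qed

lemma profile_nonneg: "barenblatt_profile d p m C t r \<ge> 0"
  by (simp add: barenblatt_profile_def)

lemma scale_pos: "C > 0 \<Longrightarrow> t > 0 \<Longrightarrow> scale C t > 0"
  by (simp add: scale_def)

text \<open>This compactness of the support later yields a finite first moment.\<close>

lemma profile_eq_0:
  assumes "C > 0" "t > 0" "r \<ge> radius / scale C t"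
  shows "barenblatt_profile d p m C t r = 0"
proof -
  have s: "scale C t > 0" using assms by (simp add: scale_pos)
  then have "radius / scale C t > 0" using radius_pos by simp
  then have "r \<ge> 0" using assms(3) by linarith
  moreover have "scale C t * r \<ge> radius"
    using assms(3) s by (simp add: pos_divide_le_eq mult.commute)
  ultimately show ?thesis
    using assms radius_less_iff[of "scale C t * r"] radius_pos by (simp add: profile_eq max_def)
qed

lemma profile_unit_integrand:
  assumes "C > 0" "t > 0"
  shows "indicator {0..} r * (barenblatt_profile d p m C t r * r ^ (d - 1)) =
    t powr (- (real d / bar_beta d p m)) * C powr bar_gamma p m / scale C t ^ (d - 1)
      * unit_integrand (scale C t * r)"
proof (cases "r \<ge> 0")
  case True
  then have "scale C t * r \<ge> 0" using scale_pos[OF assms] by simp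
  with True show ?thesis
    using scale_pos[OF assms] by (simp add: unit_integrand_def profile_eq[OF assms] power_mult_distrib)
next
  case False
  then have "scale C t * r < 0" using scale_pos[OF assms] by (simp add: mult_pos_neg)
  with False show ?thesis by (simp add: unit_integrand_def)
qed

lemma integrable_profile:
  assumes "C > 0" "t > 0"
  shows "integrable lborel (\<lambda>r. indicator {0..} r * (barenblatt_profile d p m C t r * r ^ (d - 1)))"
proof -
  have "scale C t \<noteq> 0" using scale_pos[OF assms] by simp
  from lborel_integrable_real_affine[OF unit_integrand_integrable this, of 0]
  have "integrable lborel (\<lambda>r. unit_integrand (scale C t * r))"
    unfolding add_0 .
  then show ?thesis
    unfolding profile_unit_integrand[OF assms] by (intro integrable_mult_right)
qed

text \<open>Substituting s = \<open>scale C t\<close> * r produces the factor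
  \<open>scale C t\<close> to the power -d. Its time part t^(d/\<beta>) cancels the prefactor
  t^(-d/\<beta>), and its other part adds d(p-1)/p to the exponent of C.\<close>

lemma integral_profile:
  assumes "C > 0" "t > 0"
  shows "(LBINT r:{0..}. barenblatt_profile d p m C t r * r ^ (d - 1)) =
    C powr (bar_gamma p m + real d * (p - 1) / p) * integral\<^sup>L lborel unit_integrand"
proof -
  let ?s = "scale C t"
  have s: "?s > 0" by (rule scale_pos[OF assms])
  have "(LBINT r:{0..}. barenblatt_profile d p m C t r * r ^ (d - 1)) =
      t powr (- (real d / bar_beta d p m)) * C powr bar_gamma p m / ?s ^ (d - 1) *
      (LBINT r. unit_integrand (?s * r))"
    unfolding set_lebesgue_integral_def real_scaleR_def profile_unit_integrand[OF assms]
    by (rule integral_mult_right_zero)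
  also have "(LBINT r. unit_integrand (?s * r)) = integral\<^sup>L lborel unit_integrand / ?s"
  proof -
    have "integral\<^sup>L lborel unit_integrand = \<bar>?s\<bar> *\<^sub>R (LBINT r. unit_integrand (0 + ?s * r))"
      using s by (intro lborel_integral_real_affine) simp
    then have "integral\<^sup>L lborel unit_integrand = ?s * (LBINT r. unit_integrand (?s * r))"
      unfolding add_0 using s by simp
    then show ?thesis using s by (metis nonzero_mult_div_cancel_left less_irrefl)
  qed
  also have "t powr (- (real d / bar_beta d p m)) * C powr bar_gamma p m / ?s ^ (d - 1) *
      (integral\<^sup>L lborel unit_integrand / ?s) =
      t powr (- (real d / bar_beta d p m)) * C powr bar_gamma p m / ?s powr real d
      * integral\<^sup>L lborel unit_integrand"
    using s d by (simp add: powr_realpow power_eq_if)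
  also have "?s powr real d = t powr (- (real d / bar_beta d p m)) * C powr (- (real d * (p - 1) / p))"
    using assms by (simp add: scale_def powr_mult powr_powr mult.commute)
  finally show ?thesis
    using assms by (simp add: powr_add powr_minus field_simps)
qed

lemma unit_sphere_area_pos: "unit_sphere_area d > 0"
  using d by (simp add: unit_sphere_area_def)

lemma barenblatt_const:
  shows barenblatt_const_pos: "barenblatt_const d p m > 0"
    and barenblatt_const_mass: "t > 0 \<Longrightarrow> unit_sphere_area d *
      (LBINT r:{0..}. barenblatt_profile d p m (barenblatt_const d p m) t r * r ^ (d - 1)) = 1"
proof -
  define e where "e = bar_gamma p m + real d * (p - 1) / p"
  define k where "k = unit_sphere_area d * integral\<^sup>L lborel unit_integrand"
  have e: "e > 0" using gamma_pos p by (simp add: e_def add_pos_nonneg)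
  have k: "k > 0" using unit_mass_pos unit_sphere_area_pos by (simp add: k_def)
  let ?P = "\<lambda>C. C > 0 \<and> (\<forall>t>0. unit_sphere_area d *
    (LBINT r:{0..}. barenblatt_profile d p m C t r * r ^ (d - 1)) = 1)"
  have mass: "unit_sphere_area d *
      (LBINT r:{0..}. barenblatt_profile d p m C t r * r ^ (d - 1)) = C powr e * k"
    if "C > 0" "t > 0" for C t
    unfolding integral_profile[OF that] e_def k_def by (simp only: mult.left_commute)
  have "?P C \<longleftrightarrow> C > 0 \<and> (\<forall>t::real>0. C powr e * k = 1)" for C
    using mass by auto
  \<comment> \<open>The mass is constant in t, so the quantifier over t > 0 collapses because some
    positive t exists.\<close>
  then have P: "?P C \<longleftrightarrow> C > 0 \<and> C powr e = 1 / k" for C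
    using k by (auto simp: field_simps intro: gt_ex)
  have "\<exists>!C. ?P C"
    unfolding P
  \<comment> \<open>As e > 0, the equation C^e = 1/k is solved by taking the e-th root.\<close>
  proof (rule ex1I)
    show "(1 / k) powr (1 / e) > 0 \<and> ((1 / k) powr (1 / e)) powr e = 1 / k"
      using e k by (simp add: powr_powr)
    show "C = (1 / k) powr (1 / e)" if "C > 0 \<and> C powr e = 1 / k" for C
      using that e powr_powr[of C e "1 / e"] by simp
  qed
  from theI'[OF this] have "?P (barenblatt_const d p m)"
    unfolding barenblatt_const_def .
  then show "barenblatt_const d p m > 0"
    "t > 0 \<Longrightarrow> unit_sphere_area d *
      (LBINT r:{0..}. barenblatt_profile d p m (barenblatt_const d p m) t r * r ^ (d - 1)) = 1"
    by auto
qed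

end

section \<open>The flow as translates of one boundedly supported law\<close>

lemma barenblatt_measurable [measurable]:
  "barenblatt p m (x :: 'a::euclidean_space) t \<in> borel_measurable borel"
  unfolding barenblatt_def barenblatt_profile_def by measurable

text \<open>For nonzero t the density depends on y - x only and Lebesgue measure is translation
  invariant; at t = 0 a point mass is moved.\<close>

lemma barenblatt_flow_translate:
  "barenblatt_flow p m t (x :: 'a::euclidean_space) = distr (barenblatt_flow p m t 0) borel ((+) x)"
proof (cases "t = 0")
  case True
  then show ?thesis by (simp add: barenblatt_flow_def distr_return)
next
  case False
  have "density lborel (\<lambda>y. ennreal (barenblatt p m x t y)) =
      density (distr lborel borel ((+) x)) (\<lambda>y. ennreal (barenblatt p m x t y))"
    by (simp add: lborel_distr_plus)
  also have "\<dots> = distr (density lborel (\<lambda>y. ennreal (barenblatt p m x t (x + y)))) borel ((+) x)"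
    by (rule density_distr) auto
  finally show ?thesis using False by (simp add: barenblatt_flow_def barenblatt_def)
qed

lemma sets_barenblatt_flow [simp]: "sets (barenblatt_flow p m t x) = sets borel"
  by (simp add: barenblatt_flow_def)

lemma
  assumes p: "p > 1" and m: "m > 0" "m * (p - 1) > 1" and t: "t \<ge> 0"
  shows prob_space_barenblatt_flow:
      "prob_space (barenblatt_flow p m t (0 :: 'a::euclidean_space))" (is ?P)
    and integrable_barenblatt_flow:
      "integrable (barenblatt_flow p m t (0 :: 'a)) (\<lambda>z. z)" (is ?I)
proof -
  interpret barenblatt_params "DIM('a)" p m
    using p m by unfold_locales (auto simp: Suc_leI)
  let ?C = "barenblatt_const DIM('a) p m" and ?\<rho> = "barenblatt_flow p m t (0 :: 'a)"
  \<comment> \<open>Both the point mass and the density case are reduced to an almost sure bound on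
    the norm, which makes the identity integrable.\<close>
  have "?P \<and> (\<exists>R. AE z in ?\<rho>. norm z \<le> R)"
  proof (cases "t = 0")
    case True
    have "AE z in ?\<rho>. norm z \<le> 0"
      unfolding barenblatt_flow_def if_P[OF True] by (subst AE_return) simp_all
    moreover have ?P
      using True by (simp add: barenblatt_flow_def prob_space_return)
    ultimately show ?thesis by blast
  next
    case False
    with t have t: "t > 0" by simp
    have [measurable]: "barenblatt_profile DIM('a) p m ?C t \<in> borel_measurable borel"
      unfolding barenblatt_profile_def by measurable
    let ?g = "\<lambda>r. indicator {0..} r * (barenblatt_profile DIM('a) p m ?C t r * r ^ (DIM('a) - 1))"
    have "emeasure ?\<rho> (space ?\<rho>) =
        (\<integral>\<^sup>+y. ennreal (barenblatt_profile DIM('a) p m ?C t (norm (y :: 'a))) \<partial>lborel)"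
      using t by (simp add: barenblatt_flow_def emeasure_density barenblatt_def)
    also have "\<dots> = ennreal (unit_sphere_area DIM('a)) * (\<integral>\<^sup>+r. ennreal (?g r) \<partial>lborel)"
      by (rule nn_integral_lborel_norm) (auto simp: profile_nonneg)
    also have "(\<integral>\<^sup>+r. ennreal (?g r) \<partial>lborel) = ennreal (\<integral>r. ?g r \<partial>lborel)"
      using integrable_profile[OF barenblatt_const_pos t]
      by (intro nn_integral_eq_integral) (auto simp: profile_nonneg split: split_indicator)
    also have "ennreal (unit_sphere_area DIM('a)) * \<dots> = 1"
      using barenblatt_const_mass[OF t] unit_sphere_area_pos
      by (simp add: set_lebesgue_integral_def ennreal_mult'[symmetric])
    finally have P: ?P by (rule prob_spaceI)
    have "AE z in ?\<rho>. norm z \<le> radius / scale ?C t"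
      unfolding barenblatt_flow_def if_not_P[OF False]
    \<comment> \<open>Only points of positive density count, and by \<open>profile_eq_0\<close>
      these lie in the ball.\<close>
    proof (subst AE_density, simp, intro AE_I2 impI)
      fix z :: 'a assume "0 < ennreal (barenblatt p m 0 t z)"
      then show "norm z \<le> radius / scale ?C t"
        using profile_eq_0[OF barenblatt_const_pos t, of "norm z"]
        by (intro leI notI) (simp add: barenblatt_def)
    qed
    with P show ?thesis by blast
  qed
  then obtain R where P: ?P and R: "AE z in ?\<rho>. norm z \<le> R" by blast
  interpret prob_space ?\<rho> by fact
  show ?P by fact
  show ?I
    using R by (rule integrable_const_bound) (rule measurable_ident_sets, simp)
qed

theorem propositionA2:
  fixes p m t :: real and q :: ennreal and x y :: "'a::euclidean_space"
  assumes "p > 1" and "m > 0"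
    and "m * (p - 1) > 1"
    and "real DIM('a) * p > real DIM('a) + 1"
    and "q \<ge> 1" and "t \<ge> 0"
  shows "wasserstein TYPE('w) q (barenblatt_flow p m t x) (barenblatt_flow p m t y)
           = ennreal (norm (x - y))"
  unfolding barenblatt_flow_translate[of p m t x] barenblatt_flow_translate[of p m t y]
  using assms by (intro wasserstein_translates prob_space_barenblatt_flow
      integrable_barenblatt_flow sets_barenblatt_flow)

end
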